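(* Let $\xi>0$ be a real number, let $n\ge 2$ be an integer, and let $t_1<t_2<\dots<t_n$ be real numbers. Let $\widetilde R$ be the $n\times n$ tridiagonal matrix associated with these data as defined in the context. Then $\widetilde R$ is strictly (row) diagonally dominant, that is, $|\widetilde R_{i,i}|>\sum_{j\neq i}|\widetilde R_{i,j}|$ for every $i=1,\dots,n$. In particular, $\widetilde R$ is invertible.
   Context: For $\xi>0$ define the functions on $\mathbb{R}$ $$\Phi_\xi(t)=\frac{1}{2\xi^3}\bigl(\xi t\cosh(\xi t)-\sinh(\xi t)\bigr),\qquad \psi_\xi(t)=\frac{1}{\xi}\sinh(\xi t).$$ For $j=1,\dots,n-1$ define the functions of $t\in\mathbb{R}$ $$A_j^{[2]}(t)=\frac{\sinh\bigl(\xi(t-t_{j+1})\bigr)}{\sinh\bigl(\xi(t_j-t_{j+1})\bigr)},\qquad B_j^{[2]}(t)=\frac{\sinh\bigl(\xi(t-t_j)\bigr)}{\sinh\bigl(\xi(t_{j+1}-t_j)\bigr)},$$ $$A_j^{[1]}(t)=\frac{\Phi_\xi(t-t_{j+1})}{\psi_\xi(t_j-t_{j+1})}-A_j^{[2]}(t)\,\frac{\Phi_\xi(t_j-t_{j+1})}{\psi_\xi(t_j-t_{j+1})},$$ $$B_j^{[1]}(t)=\frac{\Phi_\xi(t-t_j)}{\psi_\xi(t_{j+1}-t_j)}-\frac{\Phi_\xi(t_{j+1}-t_j)}{\psi_\xi(t_{j+1}-t_j)}\,B_j^{[2]}(t).$$ The $n\times n$ matrix $\widetilde R$ has the following entries,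 where $\frac{d}{dt}F(s)$ denotes the derivative of $F$ evaluated at $s$. First row: $\widetilde R_{1,1}=\frac{d}{dt}A_1^{[1]}(t_1)$ and $\widetilde R_{1,2}=\frac{d}{dt}B_1^{[1]}(t_1)$. Rows $j=2,\dots,n-1$: $$\widetilde R_{j,j-1}=\frac{d}{dt}A_{j-1}^{[1]}(t_j),\quad \widetilde R_{j,j}=\frac{d}{dt}B_{j-1}^{[1]}(t_j)-\frac{d}{dt}A_j^{[1]}(t_j),\quad \widetilde R_{j,j+1}=-\frac{d}{dt}B_j^{[1]}(t_j).$$ Last row: $\widetilde R_{n,n-1}=\frac{d}{dt}A_{n-1}^{[1]}(t_n)$ and $\widetilde R_{n,n}=\frac{d}{dt}B_{n-1}^{[1]}(t_n)$. All other entries are $0$. (This is the coefficient matrix of the linear system for the unknowns $\gamma_j=L_\xi g(t_j)$, with $L_\xi=\frac{d^2}{dt^2}-\xi^2$, where $g\in C^2[t_1,t_n]$ satisfies $L_\xi^2 g=0$ on each $(t_j,t_{j+1})$, interpolates prescribed values $g_j$ at $t_j$, and has prescribed endpoint derivatives $g'(t_1)$, $g'(t_n)$.) *)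

theory Defs
  imports "HOL-Analysis.Derivative" "Jordan_Normal_Form.Matrix"
begin

definition Phi :: "real \<Rightarrow> real \<Rightarrow> real" where
  "Phi \<xi> t = 1 / (2 * \<xi> ^ 3) * (\<xi> * t * cosh (\<xi> * t) - sinh (\<xi> * t))"

definition psi :: "real \<Rightarrow> real \<Rightarrow> real" where
  "psi \<xi> t = 1 / \<xi> * sinh (\<xi> * t)"

text \<open>The knots $t_1 < \dots < t_n$ are given by a function \<open>t\<close> on \<open>nat\<close>,
  of which only the values at \<open>1, \<dots>, n\<close> are used; the real variable of the
  basis functions is \<open>s\<close>.\<close>

definition A2 :: "real \<Rightarrow> (nat \<Rightarrow> real) \<Rightarrow> nat \<Rightarrow> real \<Rightarrow> real" where
  "A2 \<xi> t j s = sinh (\<xi> * (s - t (j + 1))) / sinh (\<xi> * (t j - t (j + 1)))"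

definition B2 :: "real \<Rightarrow> (nat \<Rightarrow> real) \<Rightarrow> nat \<Rightarrow> real \<Rightarrow> real" where
  "B2 \<xi> t j s = sinh (\<xi> * (s - t j)) / sinh (\<xi> * (t (j + 1) - t j))"

definition A1 :: "real \<Rightarrow> (nat \<Rightarrow> real) \<Rightarrow> nat \<Rightarrow> real \<Rightarrow> real" where
  "A1 \<xi> t j s =
     Phi \<xi> (s - t (j + 1)) / psi \<xi> (t j - t (j + 1))
     - A2 \<xi> t j s * (Phi \<xi> (t j - t (j + 1)) / psi \<xi> (t j - t (j + 1)))"

definition B1 :: "real \<Rightarrow> (nat \<Rightarrow> real) \<Rightarrow> nat \<Rightarrow> real \<Rightarrow> real" where
  "B1 \<xi> t j s =
     Phi \<xi> (s - t j) / psi \<xi> (t (j + 1) - t j)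
     - Phi \<xi> (t (j + 1) - t j) / psi \<xi> (t (j + 1) - t j) * B2 \<xi> t j s"

text \<open>Entry in row \<open>i\<close> and column \<open>j\<close>, both counted from \<open>1\<close>.\<close>

definition R_entry :: "real \<Rightarrow> nat \<Rightarrow> (nat \<Rightarrow> real) \<Rightarrow> nat \<Rightarrow> nat \<Rightarrow> real" where
  "R_entry \<xi> n t i j =
     (if i = 1 then
        (if j = 1 then deriv (A1 \<xi> t 1) (t 1)
         else if j = 2 then deriv (B1 \<xi> t 1) (t 1)
         else 0)
      else if i = n then
        (if j = n - 1 then deriv (A1 \<xi> t (n - 1)) (t n)
         else if j = n then deriv (B1 \<xi> t (n - 1)) (t n)
         else 0)
      else
        (if j = i - 1 then deriv (A1 \<xi> t (i - 1)) (t i)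
         else if j = i then deriv (B1 \<xi> t (i - 1)) (t i) - deriv (A1 \<xi> t i) (t i)
         else if j = i + 1 then - deriv (B1 \<xi> t i) (t i)
         else 0))"

text \<open>Indices of the type \<open>mat\<close> start at \<open>0\<close>, hence the shift.\<close>

definition R_mat :: "real \<Rightarrow> nat \<Rightarrow> (nat \<Rightarrow> real) \<Rightarrow> real mat" where
  "R_mat \<xi> n t = mat n n (\<lambda>(i, j). R_entry \<xi> n t (i + 1) (j + 1))"

definition strictly_diag_dominant :: "real mat \<Rightarrow> bool" where
  "strictly_diag_dominant M \<longleftrightarrow> square_mat M \<and>
     (\<forall>i < dim_row M. \<bar>M $$ (i, i)\<bar> > (\<Sum>j \<in> {..<dim_col M} - {i}. \<bar>M $$ (i, j)\<bar>))"

end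

theory Submission
  imports Defs "Jordan_Normal_Form.Determinant"
begin

text \<open>The derivatives of the basis functions at the endpoints of an interval of length \<open>h\<close> are,
  with \<open>x = \<xi> * h\<close>, up to sign the two numbers
  \<open>d = (sinh x * cosh x - x) / (2 * \<xi> * sinh x ^ 2)\<close> and
  \<open>e = (x * cosh x - sinh x) / (2 * \<xi> * sinh x ^ 2)\<close>.
  An interval adjacent to a knot contributes \<open>d\<close> to the diagonal entry and \<open>e\<close> (up to sign) to an
  off-diagonal one, and the diagonal contributions of the two neighbouring intervals have the same
  sign. So everything reduces to \<open>\<bar>e\<bar> < d\<close>, which follows from \<open>x < sinh x\<close> by the factorizations
  \<open>(sinh x * cosh x - x) - (x * cosh x - sinh x) = (sinh x - x) * (cosh x + 1)\<close> and
  \<open>(sinh x * cosh x - x) + (x * cosh x - sinh x) = (sinh x + x) * (cosh x - 1)\<close>.\<close>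

unbundle no vec_syntax

text \<open>The difference \<open>sinh u - u\<close> vanishes at 0 and has derivative
  \<open>cosh u - 1\<close>, which is positive for \<open>u > 0\<close>.\<close>

lemma less_sinh_real:
  fixes x :: real
  assumes "0 < x"
  shows "x < sinh x"
proof -
  have "(\<lambda>u::real. sinh u - u) 0 < (\<lambda>u. sinh u - u) x"
  proof (rule DERIV_pos_imp_increasing_open[OF assms])
    fix u :: real assume u: "0 < u" "u < x"
    have "cosh u > 1"
      using cosh_real_ge_1[of u] cosh_real_one_iff[of u] u by linarith
    moreover have "((\<lambda>u. sinh u - u) has_real_derivative cosh u - 1) (at u)"
      by (auto intro!: derivative_eq_intros)
    ultimately show "\<exists>y. ((\<lambda>u. sinh u - u) has_real_derivative y) (at u) \<and> y > 0"
      by (intro exI[of _ "cosh u - 1"]) simp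
  qed (intro continuous_intros)
  then show ?thesis by simp
qed

definition diag_coeff :: "real \<Rightarrow> real \<Rightarrow> real" where
  "diag_coeff \<xi> h = (sinh (\<xi> * h) * cosh (\<xi> * h) - \<xi> * h) / (2 * \<xi> * sinh (\<xi> * h) ^ 2)"

definition off_coeff :: "real \<Rightarrow> real \<Rightarrow> real" where
  "off_coeff \<xi> h = (\<xi> * h * cosh (\<xi> * h) - sinh (\<xi> * h)) / (2 * \<xi> * sinh (\<xi> * h) ^ 2)"

lemma abs_off_coeff_less_diag_coeff:
  assumes "0 < \<xi>" "0 < h"
  shows "\<bar>off_coeff \<xi> h\<bar> < diag_coeff \<xi> h"
proof -
  define x S C where "x = \<xi> * h" and "S = sinh x" and "C = cosh x"
  have x: "0 < x" using assms by (simp add: x_def)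
  have S: "x < S" using less_sinh_real[OF x] by (simp add: S_def)
  have C: "1 < C"
    using cosh_real_ge_1[of x] cosh_real_one_iff[of x] x unfolding C_def by linarith
  have "0 < (S - x) * (C + 1)" "0 < (S + x) * (C - 1)"
    using x S C by (auto intro!: mult_pos_pos)
  then have "\<bar>x * C - S\<bar> < S * C - x"
    by (simp add: algebra_simps abs_less_iff)
  moreover have "0 < 2 * \<xi> * S ^ 2" using assms x S by simp
  ultimately show ?thesis
    by (simp add: diag_coeff_def off_coeff_def divide_strict_right_mono
          abs_of_pos x_def[symmetric] S_def[symmetric] C_def[symmetric])
qed

text \<open>The two \<open>cosh\<close> terms from the product rule and from \<open>sinh\<close>
  cancel, so only the term with \<open>sinh\<close> survives.\<close>

lemma Phi_has_real_derivative:
  assumes "\<xi> \<noteq> 0"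
  shows "(Phi \<xi> has_real_derivative u * sinh (\<xi> * u) / (2 * \<xi>)) (at u)"
proof -
  have "((\<lambda>u. \<xi> * u * cosh (\<xi> * u) - sinh (\<xi> * u)) has_real_derivative
      \<xi> ^ 2 * (u * sinh (\<xi> * u))) (at u)"
    by (auto intro!: derivative_eq_intros simp: power2_eq_square)
  from DERIV_cmult[OF this, of "1 / (2 * \<xi> ^ 3)"] show ?thesis
    unfolding Phi_def[abs_def] using assms by (simp add: power2_eq_square power3_eq_cube)
qed

lemma Phi_shift_has_real_derivative:
  assumes "\<xi> \<noteq> 0"
  shows "((\<lambda>s. Phi \<xi> (s - a)) has_real_derivative
     (s - a) * sinh (\<xi> * (s - a)) / (2 * \<xi>)) (at s)"
proof -
  have "((\<lambda>s. s - a) has_real_derivative 1) (at s)"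
    by (auto intro!: derivative_eq_intros)
  from DERIV_chain2[OF Phi_has_real_derivative[OF assms] this] show ?thesis by simp
qed

lemma sinh_shift_has_real_derivative:
  "((\<lambda>s. sinh (\<xi> * (s - a))) has_real_derivative \<xi> * cosh (\<xi> * (s - a))) (at s)" for \<xi> :: real
  by (auto intro!: derivative_eq_intros)

text \<open>The derivative keeps the shape that the differentiation rules produce; it is simplified
  only at the knots, where \<open>s - t (j + 1)\<close> is 0 or minus the length of the
  interval.\<close>

lemma A1_has_real_derivative:
  assumes "\<xi> \<noteq> 0"
  shows "(A1 \<xi> t j has_real_derivative
     (s - t (j + 1)) * sinh (\<xi> * (s - t (j + 1))) / (2 * \<xi>) / psi \<xi> (t j - t (j + 1))
     - \<xi> * cosh (\<xi> * (s - t (j + 1))) / sinh (\<xi> * (t j - t (j + 1)))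
       * (Phi \<xi> (t j - t (j + 1)) / psi \<xi> (t j - t (j + 1)))) (at s)"
  unfolding A1_def[abs_def] A2_def[abs_def]
  by (intro DERIV_diff DERIV_cmult_right DERIV_cdivide Phi_shift_has_real_derivative
        sinh_shift_has_real_derivative assms)

lemma B1_has_real_derivative:
  assumes "\<xi> \<noteq> 0"
  shows "(B1 \<xi> t j has_real_derivative
     (s - t j) * sinh (\<xi> * (s - t j)) / (2 * \<xi>) / psi \<xi> (t (j + 1) - t j)
     - Phi \<xi> (t (j + 1) - t j) / psi \<xi> (t (j + 1) - t j)
       * (\<xi> * cosh (\<xi> * (s - t j)) / sinh (\<xi> * (t (j + 1) - t j)))) (at s)"
  unfolding B1_def[abs_def] B2_def[abs_def]
  by (intro DERIV_diff DERIV_cmult DERIV_cdivide Phi_shift_has_real_derivative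
        sinh_shift_has_real_derivative assms)

text \<open>In each derivative the first summand is 0 at one knot and, up to sign,
  \<open>h / 2\<close> at the other. The second carries the factor \<open>cosh\<close>, which is 1
  at the former knot and \<open>cosh (\<xi> * h)\<close> at the latter.\<close>

lemma deriv_basis_functions_at_knots:
  assumes "0 < \<xi>" "t j < t (Suc j)"
  defines "h \<equiv> t (Suc j) - t j"
  shows "deriv (A1 \<xi> t j) (t j) = - diag_coeff \<xi> h"
    and "deriv (A1 \<xi> t j) (t (Suc j)) = off_coeff \<xi> h"
    and "deriv (B1 \<xi> t j) (t j) = - off_coeff \<xi> h"
    and "deriv (B1 \<xi> t j) (t (Suc j)) = diag_coeff \<xi> h"
proof -
  define S C where "S = sinh (\<xi> * h)" and "C = cosh (\<xi> * h)"
  \<comment> \<open>\<open>Phi\<close> and \<open>psi\<close> are both odd, so their quotient is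
    even and \<open>q\<close> serves for \<open>h\<close> and \<open>- h\<close> alike.\<close>
  define q where "q = (\<xi> * h * C - S) / (2 * \<xi> ^ 2 * S)"
  have "0 < \<xi> * h" using assms by simp
  then have S: "0 < S" using less_sinh_real[of "\<xi> * h"] by (simp add: S_def)
  have neg: "t j - t (Suc j) = - h" by (simp add: h_def)
  have q: "Phi \<xi> h / psi \<xi> h = q" "Phi \<xi> (- h) / psi \<xi> (- h) = q"
    using assms(1) S unfolding Phi_def psi_def q_def
    by (simp_all add: S_def[symmetric] C_def[symmetric] divide_simps)
       (simp_all add: algebra_simps power2_eq_square power3_eq_cube)
  have off: "\<xi> / S * q = off_coeff \<xi> h"
    using assms(1) S unfolding q_def off_coeff_def
    by (simp add: S_def[symmetric] C_def[symmetric] power2_eq_square)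
  \<comment> \<open>Multiplying by the denominator of \<open>diag_coeff\<close> clears all
    fractions; what remains follows from \<open>C ^ 2 = S ^ 2 + 1\<close>.\<close>
  have "(h / 2 - \<xi> * C / S * q) * (2 * \<xi> * S ^ 2) = \<xi> * h * S ^ 2 - C * (q * (2 * \<xi> ^ 2 * S))"
    using S by (simp add: field_simps power2_eq_square)
  also have "q * (2 * \<xi> ^ 2 * S) = \<xi> * h * C - S"
    using assms(1) S unfolding q_def by simp
  also have "\<xi> * h * S ^ 2 - C * (\<xi> * h * C - S) = \<xi> * h * S ^ 2 - \<xi> * h * C ^ 2 + S * C"
    by (simp add: algebra_simps power2_eq_square)
  also have "\<dots> = S * C - \<xi> * h"
    unfolding S_def C_def by (simp add: cosh_square_eq algebra_simps)
  finally have diag: "h / 2 - \<xi> * C / S * q = diag_coeff \<xi> h"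
    using assms(1) S unfolding diag_coeff_def
    by (simp add: S_def[symmetric] C_def[symmetric] eq_divide_eq)
  \<comment> \<open>These are the first summands of the derivatives of \<open>A1\<close> at
    \<open>t j\<close> and of \<open>B1\<close> at \<open>t (Suc j)\<close>.\<close>
  have half: "- h * - S / (2 * \<xi>) / psi \<xi> (- h) = - (h / 2)" "h * S / (2 * \<xi> * psi \<xi> h) = h / 2"
    using assms(1) S unfolding psi_def by (simp_all add: S_def[symmetric])
  note derivs = A1_has_real_derivative[THEN DERIV_imp_deriv]
    B1_has_real_derivative[THEN DERIV_imp_deriv]
  show "deriv (A1 \<xi> t j) (t j) = - diag_coeff \<xi> h"
    using assms(1) half(1) unfolding diag[symmetric]
    by (simp add: derivs neg q S_def[symmetric] C_def[symmetric])
  show "deriv (A1 \<xi> t j) (t (Suc j)) = off_coeff \<xi> h"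
    using assms(1) unfolding off[symmetric]
    by (simp add: derivs neg q S_def[symmetric])
  show "deriv (B1 \<xi> t j) (t j) = - off_coeff \<xi> h"
    using assms(1) unfolding off[symmetric]
    by (simp add: derivs h_def[symmetric] q S_def[symmetric])
  show "deriv (B1 \<xi> t j) (t (Suc j)) = diag_coeff \<xi> h"
    using assms(1) unfolding diag[symmetric]
    by (simp add: derivs h_def[symmetric] q half(2) S_def[symmetric] C_def[symmetric])
qed

text \<open>A nonzero determinant makes \<open>M\<close> a unit of the ring of square matrices, and
  the inverse in that ring is the required one. The argument \<open>()\<close> only fills the
  extension slot of the ring record.\<close>

lemma invertible_mat_if_det_nonzero:
  fixes M :: "'a :: field mat"
  assumes "M \<in> carrier_mat n n" "det M \<noteq> 0"
  shows "invertible_mat M"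
  using det_non_zero_imp_unit[OF assms, of "()"] assms(1)
  by (auto simp: Units_def ring_mat_def invertible_mat_def inverts_mat_def)

text \<open>The Levy-Desplanques theorem: evaluate a kernel vector in the row where its entry has
  maximal modulus.\<close>

lemma strictly_diag_dominant_invertible:
  assumes "strictly_diag_dominant M"
  shows "invertible_mat M"
proof -
  define n where "n = dim_row M"
  have M: "M \<in> carrier_mat n n" and dom:
    "\<And>i. i < n \<Longrightarrow> (\<Sum>j \<in> {..<n} - {i}. \<bar>M $$ (i, j)\<bar>) < \<bar>M $$ (i, i)\<bar>"
    using assms by (auto simp: strictly_diag_dominant_def n_def)
  have "det M \<noteq> 0"
  proof
    assume "det M = 0"
    then obtain v where v: "v \<in> carrier_vec n" "v \<noteq> 0\<^sub>v n" "M *\<^sub>v v = 0\<^sub>v n"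
      using det_0_iff_vec_prod_zero[OF M] by auto
    then obtain k where k: "k < n" "v $ k \<noteq> 0" by (auto simp: vec_eq_iff)
    define m where "m = Max ((\<lambda>j. \<bar>v $ j\<bar>) ` {..<n})"
    have le: "\<bar>v $ j\<bar> \<le> m" if "j < n" for j
      unfolding m_def using that by (intro Max_ge) auto
    have "m \<in> (\<lambda>j. \<bar>v $ j\<bar>) ` {..<n}"
      unfolding m_def using k by (intro Max_in) auto
    then obtain i where i: "i < n" "m = \<bar>v $ i\<bar>" by auto
    have m: "0 < m" using le[OF k(1)] k(2) by simp
    have "0 = (M *\<^sub>v v) $ i" using v i by simp
    also have "\<dots> = (\<Sum>j<n. M $$ (i, j) * v $ j)"
      using M v(1) i by (simp add: scalar_prod_def atLeast0LessThan)
    also have "\<dots> = M $$ (i, i) * v $ i + (\<Sum>j \<in> {..<n} - {i}. M $$ (i, j) * v $ j)"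
      using i by (intro sum.remove) auto
    \<comment> \<open>Row \<open>i\<close> of \<open>M *\<^sub>v v = 0\<^sub>v n\<close> says that
      the diagonal term is the negative of the sum of the others.\<close>
    finally have "\<bar>M $$ (i, i)\<bar> * m = \<bar>\<Sum>j \<in> {..<n} - {i}. M $$ (i, j) * v $ j\<bar>"
      unfolding i(2) abs_mult[symmetric] by linarith
    also have "\<dots> \<le> (\<Sum>j \<in> {..<n} - {i}. \<bar>M $$ (i, j)\<bar> * m)"
      by (intro order.trans[OF sum_abs] sum_mono) (auto simp: abs_mult intro!: mult_left_mono le)
    also have "\<dots> = (\<Sum>j \<in> {..<n} - {i}. \<bar>M $$ (i, j)\<bar>) * m"
      by (simp add: sum_distrib_right)
    also have "\<dots> < \<bar>M $$ (i, i)\<bar> * m"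
      using dom[OF i(1)] m by simp
    finally show False by simp
  qed
  with M show ?thesis by (rule invertible_mat_if_det_nonzero)
qed

lemma R_mat_strictly_diag_dominant:
  assumes "0 < \<xi>" "2 \<le> n" and mono: "strict_mono_on {1..n} t"
  shows "strictly_diag_dominant (R_mat \<xi> n t)"
proof -
  define d where "d j = diag_coeff \<xi> (t (Suc j) - t j)" for j
  define e where "e j = off_coeff \<xi> (t (Suc j) - t j)" for j
  have t: "t j < t (Suc j)" if "1 \<le> j" "j < n" for j
    using mono that by (auto intro: strict_mono_onD)
  have de: "\<bar>e j\<bar> < d j" if "1 \<le> j" "j < n" for j
    unfolding d_def e_def using assms(1) t[OF that] by (intro abs_off_coeff_less_diag_coeff) auto
  have derivs: "deriv (A1 \<xi> t j) (t j) = - d j" "deriv (A1 \<xi> t j) (t (Suc j)) = e j"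
      "deriv (B1 \<xi> t j) (t j) = - e j" "deriv (B1 \<xi> t j) (t (Suc j)) = d j"
    if "1 \<le> j" "j < n" for j
    using deriv_basis_functions_at_knots[OF assms(1) t[OF that]] by (simp_all add: d_def e_def)
  have row: "(\<Sum>j \<in> {..<n} - {i}. \<bar>R_entry \<xi> n t (Suc i) (Suc j)\<bar>)
      < \<bar>R_entry \<xi> n t (Suc i) (Suc i)\<bar>" if i: "i < n" for i
  proof -
    \<comment> \<open>First, last and interior rows; the interior case is empty for
      \<open>n = 2\<close>.\<close>
    consider "i = 0" | "i \<noteq> 0" "Suc i = n" | "i \<noteq> 0" "Suc i < n" using i by linarith
    then show ?thesis
    proof cases
      case 1
      have "(\<Sum>j \<in> {..<n} - {i}. \<bar>R_entry \<xi> n t (Suc i) (Suc j)\<bar>)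
          = (\<Sum>j \<in> {1}. \<bar>R_entry \<xi> n t (Suc i) (Suc j)\<bar>)"
        using 1 assms(2) by (intro sum.mono_neutral_right) (auto simp: R_entry_def)
      then show ?thesis
        using 1 de[of 1] derivs[of 1] assms(2) by (simp add: R_entry_def)
    next
      case 2
      \<comment> \<open>Counted from 1, the last interval is number \<open>n - 1 = Suc k\<close>,
        while column \<open>n - 1\<close> has the shifted index \<open>k\<close>.\<close>
      then obtain k where k: "i = Suc k" "n = Suc (Suc k)" by (cases i) auto
      have "(\<Sum>j \<in> {..<n} - {i}. \<bar>R_entry \<xi> n t (Suc i) (Suc j)\<bar>)
          = (\<Sum>j \<in> {k}. \<bar>R_entry \<xi> n t (Suc i) (Suc j)\<bar>)"
        using k by (intro sum.mono_neutral_right) (auto simp: R_entry_def)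
      then show ?thesis
        using k de[of "Suc k"] derivs[of "Suc k"] by (simp add: R_entry_def)
    next
      case 3
      \<comment> \<open>The knot \<open>t (Suc (Suc k))\<close> lies between intervals
        \<open>Suc k\<close> and \<open>Suc (Suc k)\<close>. The diagonal entry is the sum of their
        two values of \<open>d\<close>, so the two bounds from \<open>de\<close> add up.\<close>
      then obtain k where k: "i = Suc k" "Suc (Suc k) < n" by (cases i) auto
      have "(\<Sum>j \<in> {..<n} - {i}. \<bar>R_entry \<xi> n t (Suc i) (Suc j)\<bar>)
          = (\<Sum>j \<in> {k, Suc (Suc k)}. \<bar>R_entry \<xi> n t (Suc i) (Suc j)\<bar>)"
        using k by (intro sum.mono_neutral_right) (auto simp: R_entry_def)
      then show ?thesis
        using k de[of "Suc k"] derivs[of "Suc k"] de[of "Suc (Suc k)"] derivs[of "Suc (Suc k)"]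
        by (simp add: R_entry_def)
    qed
  qed
  show ?thesis
    unfolding strictly_diag_dominant_def
    using row by (auto simp: R_mat_def)
qed

theorem theorem5:
  fixes \<xi> :: real and n :: nat and t :: "nat \<Rightarrow> real"
  assumes "\<xi> > 0"
    and "n \<ge> 2"
    and "strict_mono_on {1..n} t"
  shows "strictly_diag_dominant (R_mat \<xi> n t) \<and> invertible_mat (R_mat \<xi> n t)"
  using R_mat_strictly_diag_dominant[OF assms] strictly_diag_dominant_invertible by blast

end
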